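(* (1) For every integer $n \geq 5$, \[ \max N(0,2;n) = \begin{cases} 3^{n/3} & n \equiv 0 \pmod 3,\\ 11 \cdot 3^{(n-7)/3} & n \equiv 1 \pmod 3,\\ 5 \cdot 3^{(n-5)/3} & n \equiv 2 \pmod 3,\end{cases} \] and this maximum is attained at a unique partition of $n$, namely $(3,3,\dots,3)$ if $n\equiv 0 \pmod 3$, $(3,\dots,3,7)$ if $n \equiv 1 \pmod 3$, and $(3,\dots,3,5)$ if $n \equiv 2 \pmod 3$. (2) For every integer $n \geq 8$, \[ \max N(1,2;n) = \begin{cases} 2^{n/2} & n \equiv 0 \pmod 2,\\ 12\cdot 2^{(n-9)/2} & n \equiv 1 \pmod 2,\end{cases} \] and the partitions of $n$ attaining this maximum are exactly those obtained from $(2,2,\dots,2)$ (if $n$ is even) or from $(2,\dots,2,9)$ (if $n$ is odd) by performing any number of the substitutions replacing two parts $2,2$ by a single part $4$, or replacing three parts $2,2,2$ by a single part $6$.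
   Context: A partition of $n$ is a finite nondecreasing list of positive integers $\lambda = (\lambda_1 \le \dots \le \lambda_k)$ summing to $n$; its rank is $\lambda_k - k$. $N(r,2;m)$ denotes the number of partitions of $m$ whose rank is congruent to $r$ modulo $2$. For a partition $\lambda = (\lambda_1,\dots,\lambda_k)$ define $N(r,2;\lambda) := \prod_{j=1}^k N(r,2;\lambda_j)$. Letting $P(n)$ be the set of all partitions of $n$, define $\max N(r,2;n) := \max\{N(r,2;\lambda) : \lambda \in P(n)\}$. *)

theory Defs
  imports "HOL-Number_Theory.Cong" "HOL-Library.Multiset"
begin

definition partitions :: "nat \<Rightarrow> nat list set" where
  "partitions n = {xs. sorted xs \<and> (\<forall>x\<in>set xs. 0 < x) \<and> sum_list xs = n}"

(* The lists are nondecreasing, so the last entry is the largest part.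
   The rank of the empty list is meaningless; it only matters for the number 0,
   which is never a part. *)
definition part_rank :: "nat list \<Rightarrow> int" where
  "part_rank xs = int (last xs) - int (length xs)"

definition rank_count :: "int \<Rightarrow> int \<Rightarrow> nat \<Rightarrow> nat" where
  "rank_count r t m = card {xs \<in> partitions m. [part_rank xs = r] (mod t)}"

definition rank_count_partition :: "int \<Rightarrow> int \<Rightarrow> nat list \<Rightarrow> nat" where
  "rank_count_partition r t xs = (\<Prod>x\<leftarrow>xs. rank_count r t x)"

definition max_rank_count :: "int \<Rightarrow> int \<Rightarrow> nat \<Rightarrow> nat" where
  "max_rank_count r t n = Max (rank_count_partition r t ` partitions n)"

definition maximizers :: "int \<Rightarrow> int \<Rightarrow> nat \<Rightarrow> nat list set" where
  "maximizers r t n =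
     {xs \<in> partitions n. rank_count_partition r t xs = max_rank_count r t n}"

(* A single substitution; the order of parts is immaterial, so it is described on the
   multiset of parts, the result being listed in nondecreasing order again. *)
inductive subst_step :: "nat list \<Rightarrow> nat list \<Rightarrow> bool" where
  two_twos: "mset xs = M + {#2, 2#} \<Longrightarrow> mset ys = M + {#4#} \<Longrightarrow> sorted ys
      \<Longrightarrow> subst_step xs ys"
| three_twos: "mset xs = M + {#2, 2, 2#} \<Longrightarrow> mset ys = M + {#6#} \<Longrightarrow> sorted ys
      \<Longrightarrow> subst_step xs ys"

(* Max is only meaningful on finite sets, so max_rank_count relies on this. *)
lemma finite_partitions: "finite (partitions n)"
proof (rule finite_subset)
  have len: "length xs \<le> sum_list xs" if "\<forall>x\<in>set xs. 0 < x" for xs :: "nat list"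
    using that by (induction xs) (auto simp: Suc_le_eq)
  show "partitions n \<subseteq> {xs. set xs \<subseteq> {..n} \<and> length xs \<le> n}"
    using len member_le_sum_list by (fastforce simp: partitions_def)
  show "finite {xs. set xs \<subseteq> {..n} \<and> length xs \<le> n}"
    by (rule finite_lists_length_le) simp
qed

end

theory Submission
  imports Defs
begin

text \<open>The number of partitions of \<open>x\<close> of given rank parity is compared with the exponential rate of
  the best repeated part: \<open>3 ^ (x / 3)\<close> for even rank, \<open>2 ^ (x / 2)\<close> for odd rank. The number of all
  partitions grows more slowly than both, so exact counts are needed only for \<open>x < 22\<close>; they come
  from removing the smallest part, which flips the parity of the rank. The resulting bounds are
  multiplied over the parts of a partition.\<close>

section \<open>Counting partitions by smallest part and rank parity\<close>

text \<open>The exponential rates are not sharp in every residue class, and all maximizers are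
  wanted, so each bound over the parts of a list is stated for the exact maximum together with its
  equality case. For even rank the exact maximum is the supermultiplicative function
  \<open>best\<close>. For odd rank it depends on the parity of the sum: an odd sum forces an odd
  part, and even the best one, 9, falls short of the rate. The threshold 22 comes from demanding 10
  * p(n) \<le> \<open>growth n\<close> for the number p(n) of partitions of n: p(22) = 1002 against
  10240 / 10, while p(21) = 792 exceeds 7168 / 10. The factor 10 is the least integer that gives a
  strict bound at large odd parts: for n = 2 * k + 1, \<open>growth n\<close> is 7 * 2 ^ k, and
  eight times the count must stay below 6 * 2 ^ k, so the factor has to exceed 28 / 3.\<close>

definition parts_from :: "nat \<Rightarrow> nat \<Rightarrow> bool \<Rightarrow> nat list set" where
  "parts_from k n b =
     {xs. sorted xs \<and> (\<forall>x\<in>set xs. k \<le> x) \<and> sum_list xs = n \<and> even (part_rank xs) = b}"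

definition parts_count :: "nat \<Rightarrow> nat \<Rightarrow> bool \<Rightarrow> nat" where
  "parts_count k n b = card (parts_from k n b)"

definition parts_total :: "nat \<Rightarrow> nat \<Rightarrow> nat" where
  "parts_total k n = parts_count k n True + parts_count k n False"

lemma finite_parts_from: "0 < k \<Longrightarrow> finite (parts_from k n b)"
  by (rule finite_subset[OF _ finite_partitions[of n]])
     (fastforce simp: parts_from_def partitions_def)

lemma part_rank_Cons: "ys \<noteq> [] \<Longrightarrow> part_rank (x # ys) = part_rank ys - 1"
  by (simp add: part_rank_def)

lemma rank_count_eq_parts_count:
  "rank_count 0 2 n = parts_count 1 n True" "rank_count 1 2 n = parts_count 1 n False"
proof -
  have "[part_rank xs = 0] (mod 2) \<longleftrightarrow> even (part_rank xs)"
       "[part_rank xs = 1] (mod 2) \<longleftrightarrow> odd (part_rank xs)" for xs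
    by (auto simp: cong_def even_iff_mod_2_eq_zero odd_iff_mod_2_eq_one)
  then show "rank_count 0 2 n = parts_count 1 n True" "rank_count 1 2 n = parts_count 1 n False"
    by (auto simp: rank_count_def parts_count_def parts_from_def partitions_def Suc_le_eq
        intro!: arg_cong[where f = card])
qed

lemma parts_count_less:
  assumes "0 < n" "n < k"
  shows "parts_count k n b = 0"
proof -
  have "xs \<notin> parts_from k n b" for xs
    using assms by (cases xs) (auto simp: parts_from_def)
  then have "parts_from k n b = {}" by blast
  then show ?thesis by (simp add: parts_count_def)
qed

text \<open>Dropping a smallest part \<open>k\<close> keeps the last entry and shortens the list by
  one. The assumption \<open>k < n\<close> ensures that something remains; from the list [k] the
  largest part itself would be removed.\<close>

lemma parts_from_split:
  assumes "0 < k" "k < n"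
  shows "parts_from k n b = parts_from (Suc k) n b \<union> Cons k ` parts_from k (n - k) (\<not> b)"
proof (intro equalityI subsetI)
  fix xs assume xs: "xs \<in> parts_from k n b"
  then obtain y ys where y: "xs = y # ys"
    using assms by (cases xs) (auto simp: parts_from_def)
  show "xs \<in> parts_from (Suc k) n b \<union> Cons k ` parts_from k (n - k) (\<not> b)"
  proof (cases "y = k")
    case True
    with xs y assms have "ys \<noteq> []" by (auto simp: parts_from_def)
    with xs y True have "ys \<in> parts_from k (n - k) (\<not> b)"
      by (auto simp: parts_from_def part_rank_Cons)
    with y True show ?thesis by auto
  next
    case False
    with xs y have "xs \<in> parts_from (Suc k) n b" by (fastforce simp: parts_from_def)
    then show ?thesis by simp
  qed
next
  fix xs assume "xs \<in> parts_from (Suc k) n b \<union> Cons k ` parts_from k (n - k) (\<not> b)"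
  then show "xs \<in> parts_from k n b"
  proof
    assume "xs \<in> parts_from (Suc k) n b"
    then show ?thesis by (auto simp: parts_from_def dest: Suc_leD)
  next
    assume "xs \<in> Cons k ` parts_from k (n - k) (\<not> b)"
    then obtain ys where ys: "xs = k # ys" "ys \<in> parts_from k (n - k) (\<not> b)" by auto
    with assms have "ys \<noteq> []" by (auto simp: parts_from_def)
    with ys assms show ?thesis by (auto simp: parts_from_def part_rank_Cons)
  qed
qed

lemma parts_count_rec:
  assumes "0 < k" "k < n"
  shows "parts_count k n b = parts_count (Suc k) n b + parts_count k (n - k) (\<not> b)"
proof -
  have "parts_from (Suc k) n b \<inter> Cons k ` parts_from k (n - k) (\<not> b) = {}"
  proof -
    have "k # ys \<notin> parts_from (Suc k) n b" for ys
      by (simp add: parts_from_def)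
    then show ?thesis by blast
  qed
  then show ?thesis
    using assms by (simp add: parts_count_def parts_from_split card_Un_disjoint finite_parts_from
        card_image)
qed

lemma parts_count_refl:
  assumes "0 < k"
  shows "parts_count k k b = of_bool (odd k = b)"
proof -
  have "xs \<in> parts_from k k b \<longleftrightarrow> xs = [k] \<and> odd k = b" for xs
  proof
    assume xs: "xs \<in> parts_from k k b"
    then obtain y ys where y: "xs = y # ys"
      using assms by (cases xs) (auto simp: parts_from_def)
    have "ys = []" using xs y assms by (cases ys) (auto simp: parts_from_def)
    with xs y show "xs = [k] \<and> odd k = b" by (auto simp: parts_from_def part_rank_def)
  qed (auto simp: parts_from_def part_rank_def)
  then have "parts_from k k b = (if odd k = b then {[k]} else {})" by auto
  then show ?thesis by (simp add: parts_count_def)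
qed

text \<open>Two parts would already sum to at least \<open>2 * k\<close>, so only the list [n], of
  rank n - 1, is left.\<close>

lemma parts_count_single:
  assumes "0 < k" "k \<le> n" "n < 2 * k"
  shows "parts_count k n b = of_bool (odd n = b)"
  using assms(2,1,3)
proof (induction rule: inc_induct)
  case base
  then show ?case by (simp add: parts_count_refl)
next
  case (step m)
  then show ?case by (simp add: parts_count_rec[of m] parts_count_less)
qed

text \<open>The recursion as a rewrite rule for evaluation: the guard \<open>2 * k \<le> n\<close>
  hands over to \<open>parts_count_single\<close> below it, and \<open>k + 1\<close> keeps the
  arguments numerals.\<close>

lemma parts_count_rec':
  assumes "0 < k" "2 * k \<le> n"
  shows "parts_count k n b = parts_count (k + 1) n b + parts_count k (n - k) (\<not> b)"
  using assms by (simp add: parts_count_rec)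

lemma parts_total_less: "0 < n \<Longrightarrow> n < k \<Longrightarrow> parts_total k n = 0"
  by (simp add: parts_total_def parts_count_less)

lemma parts_total_refl: "0 < k \<Longrightarrow> parts_total k k = 1"
  by (simp add: parts_total_def parts_count_refl)

lemma parts_total_rec:
  "0 < k \<Longrightarrow> k < n \<Longrightarrow> parts_total k n = parts_total (Suc k) n + parts_total k (n - k)"
  by (simp add: parts_total_def parts_count_rec)

lemma parts_total_antimono:
  assumes "0 < k" "0 < n"
  shows "parts_total (Suc k) n \<le> parts_total k n"
proof (cases "k < n")
  case True
  with assms show ?thesis by (simp add: parts_total_rec)
next
  case False
  with assms show ?thesis by (simp add: parts_total_less)
qed

text \<open>Lowering the smallest part by 1 is injective and leads from parts above \<open>k\<close>
  to parts at least \<open>k\<close>. Instead of building this map, the proof compares the two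
  recursions term by term.\<close>

lemma parts_total_Suc_le:
  assumes "0 < k" "1 < n"
  shows "parts_total (Suc k) n \<le> parts_total k (n - 1)"
  using assms
proof (induction "n - k" arbitrary: k rule: less_induct)
  case less
  consider "n \<le> k" | "n = Suc k" | "Suc k < n" by linarith
  then show ?case
  proof cases
    case 1
    with less.prems show ?thesis by (simp add: parts_total_less)
  next
    case 2
    with less.prems show ?thesis by (simp add: parts_total_refl)
  next
    case 3
    have "parts_total (Suc (Suc k)) n \<le> parts_total (Suc k) (n - 1)"
      using 3 less by simp
    moreover have "parts_total (Suc k) (n - Suc k) \<le> parts_total k (n - Suc k)"
      using 3 less.prems by (intro parts_total_antimono) auto
    moreover have "parts_total (Suc k) n = parts_total (Suc (Suc k)) n + parts_total (Suc k) (n - Suc k)"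
      using 3 by (intro parts_total_rec) auto
    moreover have "parts_total k (n - 1) = parts_total (Suc k) (n - 1) + parts_total k (n - Suc k)"
      using 3 less.prems parts_total_rec[of k "n - 1"] by simp
    ultimately show ?thesis by linarith
  qed
qed

lemmas parts_count_eval =
  parts_count_rec' parts_count_single parts_count_less

section \<open>Growth of the number of partitions\<close>

text \<open>A rational substitute for a multiple of \<open>sqrt 2 ^ n\<close>. It dominates the solutions of the
  recurrence \<open>u n = u (n - 1) + u (n - 4)\<close>, which bounds the number of partitions with parts
  at least 4, because \<open>x ^ 4 = x ^ 3 + 1\<close> has its positive root 1.38 below \<open>sqrt 2\<close>.\<close>

definition growth :: "nat \<Rightarrow> nat" where
  "growth n = (if even n then 5 else 7) * 2 ^ (n div 2)"

lemma growth_add_2: "growth (n + 2) = 2 * growth n"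
  by (simp add: growth_def)

text \<open>Consecutive ratios alternate between 7/5 and 10/7, which enclose the square root of 2;
  3/2 is a coarser upper bound that suffices.\<close>

lemma growth_Suc_bounds:
  "2 * growth (n + 1) \<le> 3 * growth n" "7 * growth n \<le> 5 * growth (n + 1)"
  by (auto simp: growth_def elim!: evenE oddE)

text \<open>The recursion combined with \<open>parts_total_Suc_le\<close> bounds the count by its
  values at n - 1 and n - 4. For parts at least 3 the same argument leads to x ^ 3 = x ^ 2 + 1,
  whose root 1.47 is too large, so 4 is the first bound that works.\<close>

lemma parts_total_4_le: "22 \<le> n \<Longrightarrow> 110 * parts_total 4 n \<le> growth n"
proof (induction n rule: less_induct)
  case (less n)
  show ?case
  proof (cases "n < 26")
    case True
    with less.prems consider "n = 22" | "n = 23" | "n = 24" | "n = 25" by linarith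
    then show ?thesis
      by cases (simp_all add: growth_def parts_total_def parts_count_eval)
  next
    case False
    define m where "m = n - 4"
    have n: "n = m + 4" and m: "22 \<le> m" using False by (auto simp: m_def)
    have "parts_total 4 n \<le> parts_total 4 (m + 3) + parts_total 4 m"
      using parts_total_rec[of 4 n] parts_total_Suc_le[of 4 n] m by (simp add: n add.commute)
    moreover have "110 * parts_total 4 (m + 3) \<le> growth (m + 3)" "110 * parts_total 4 m \<le> growth m"
      using m by (intro less.IH; simp add: n)+
    \<comment> \<open>Here \<open>growth (m + 3)\<close> = 2 * \<open>growth (m + 1)\<close> \<le> 3
      * \<open>growth m\<close>, while \<open>growth n\<close> = 4 *
      \<open>growth m\<close>.\<close>
    moreover have "growth m + growth (m + 3) \<le> growth n"
      using growth_Suc_bounds(1)[of m] growth_add_2[of m] growth_add_2[of "m + 1"]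
        growth_add_2[of "m + 2"] by (simp add: n numeral_eq_Suc)
    ultimately show ?thesis by linarith
  qed
qed

lemma parts_total_3_le: "22 \<le> n \<Longrightarrow> 70 * parts_total 3 n \<le> growth n"
proof (induction n rule: less_induct)
  case (less n)
  show ?case
  proof (cases "n < 25")
    case True
    with less.prems consider "n = 22" | "n = 23" | "n = 24" by linarith
    then show ?thesis
      by cases (simp_all add: growth_def parts_total_def parts_count_eval)
  next
    case False
    define m where "m = n - 3"
    have n: "n = m + 3" and m: "22 \<le> m" using False by (auto simp: m_def)
    have "parts_total 3 n = parts_total 4 n + parts_total 3 m"
      using parts_total_rec[of 3 n] m by (simp add: n)
    moreover have "70 * parts_total 3 m \<le> growth m"
      using m by (intro less.IH; simp add: n)+
    moreover have "110 * parts_total 4 n \<le> growth n"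
      using less.prems by (rule parts_total_4_le)
    moreover have "growth n = 2 * growth (m + 1)"
      using growth_add_2[of "m + 1"] by (simp add: n numeral_eq_Suc)
    ultimately show ?thesis using growth_Suc_bounds(2)[of m] by linarith
  qed
qed

lemma parts_total_2_le: "22 \<le> n \<Longrightarrow> 35 * parts_total 2 n \<le> growth n"
proof (induction n rule: less_induct)
  case (less n)
  show ?case
  proof (cases "n < 24")
    case True
    with less.prems consider "n = 22" | "n = 23" by linarith
    then show ?thesis
      by cases (simp_all add: growth_def parts_total_def parts_count_eval)
  next
    case False
    define m where "m = n - 2"
    have n: "n = m + 2" and m: "22 \<le> m" using False by (auto simp: m_def)
    have "parts_total 2 n = parts_total 3 n + parts_total 2 m"
      using parts_total_rec[of 2 n] m by (simp add: n)
    moreover have "35 * parts_total 2 m \<le> growth m"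
      using m by (intro less.IH; simp add: n)+
    moreover have "70 * parts_total 3 n \<le> growth n"
      using less.prems by (rule parts_total_3_le)
    moreover have "growth n = 2 * growth m"
      by (simp only: n growth_add_2)
    ultimately show ?thesis by linarith
  qed
qed

lemma parts_total_1_le: "22 \<le> n \<Longrightarrow> 10 * parts_total 1 n \<le> growth n"
proof (induction rule: dec_induct)
  case base
  show ?case
    by (simp add: growth_def parts_total_def parts_count_eval del: One_nat_def)
next
  case (step m)
  have "parts_total 1 (Suc m) = parts_total 2 (Suc m) + parts_total 1 m"
    using parts_total_rec[of 1 "Suc m"] step by (simp add: numeral_2_eq_2)
  moreover have "35 * parts_total 2 (Suc m) \<le> growth (Suc m)"
    using step by (intro parts_total_2_le) simp
  ultimately show ?case using step.IH growth_Suc_bounds(2)[of m] by simp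
qed

lemma rank_count_le:
  assumes "22 \<le> n"
  shows "10 * rank_count 0 2 n \<le> growth n" "10 * rank_count 1 2 n \<le> growth n"
  using parts_total_1_le[OF assms] by (simp_all add: rank_count_eq_parts_count parts_total_def)

lemma rank_count_1_values: "rank_count 1 2 2 = 2" "rank_count 1 2 4 = 4" "rank_count 1 2 6 = 8"
  "rank_count 1 2 9 = 12"
  by (simp_all add: rank_count_eq_parts_count parts_count_eval del: One_nat_def)

lemma rank_count_0_values: "rank_count 0 2 1 = 1" "rank_count 0 2 2 = 0"
  "rank_count 0 2 3 = 3" "rank_count 0 2 4 = 1" "rank_count 0 2 5 = 5" "rank_count 0 2 6 = 3"
  "rank_count 0 2 7 = 11"
  by (simp_all add: rank_count_eq_parts_count parts_count_eval del: One_nat_def)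

section \<open>Even rank\<close>

text \<open>This is the maximum for every \<open>n\<close>, also below 5, so that an induction over
  arbitrary lists meets no gap. The sizes 5 and 7 are exceptional because 5 > 3 *
  \<open>best 2\<close> = 3 and 11 > 3 * \<open>best 4\<close> = 9.\<close>

fun best :: "nat \<Rightarrow> nat" where
  "best n = (if n < 3 then 1 else if n = 5 then 5 else if n = 7 then 11 else 3 * best (n - 3))"

fun best_parts :: "nat \<Rightarrow> nat multiset" where
  "best_parts n = (if n < 3 then replicate_mset n 1 else if n = 5 then {#5#}
     else if n = 7 then {#7#} else add_mset 3 (best_parts (n - 3)))"

declare best.simps [simp del] best_parts.simps [simp del]

lemma best_rec: "3 \<le> n \<Longrightarrow> n \<noteq> 5 \<Longrightarrow> n \<noteq> 7 \<Longrightarrow> best n = 3 * best (n - 3)"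
  by (simp add: best.simps[of n])

lemma best_parts_rec:
  "3 \<le> n \<Longrightarrow> n \<noteq> 5 \<Longrightarrow> n \<noteq> 7 \<Longrightarrow> best_parts n = add_mset 3 (best_parts (n - 3))"
  by (simp add: best_parts.simps[of n])

lemma best_pos: "0 < best n"
  by (induction n rule: best.induct) (subst best.simps, simp)

text \<open>The inequality is strict only at 2 and 4, where adding 3 hits an exceptional
  size.\<close>

lemma best_add_3: "3 * best n \<le> best (n + 3)"
proof -
  consider "n = 2" | "n = 4" | "n \<noteq> 2" "n \<noteq> 4" by blast
  then show ?thesis
    by cases (simp_all add: best.simps)
qed

lemma best_cases:
  obtains "n \<in> {0, 1, 2, 5, 7}" | m where "n = m + 3" "best n = 3 * best m"
proof (cases "n \<in> {0, 1, 2, 5, 7}")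
  case False
  then have "n = n - 3 + 3" "best n = 3 * best (n - 3)" by (auto simp: best_rec)
  then show ?thesis by (rule that(2))
qed (rule that(1))

text \<open>A 3 is peeled off either argument outside {0, 1, 2, 5, 7} and put back by
  \<open>best_add_3\<close>; what remains is a finite table.\<close>

lemma best_mult: "best m * best n \<le> best (m + n)"
proof (induction "m + n" arbitrary: m n rule: less_induct)
  case less
  have step: "best (p + 3) * best q \<le> best (p + 3 + q)"
    if "p + 3 + q = m + n" "best (p + 3) = 3 * best p" for p q
  proof -
    have "best p * best q \<le> best (p + q)" using that by (intro less) auto
    also have "3 * \<dots> \<le> best (p + q + 3)" by (rule best_add_3)
    finally show ?thesis using that by (simp add: algebra_simps)
  qed
  show ?case
  proof (cases m rule: best_cases)
    case (2 p)
    then show ?thesis using step[of p n] by simp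
  next
    case 1
    show ?thesis
    proof (cases n rule: best_cases)
      case (2 p)
      then show ?thesis using step[of p m] by (simp add: algebra_simps)
    next
      case 1
      with \<open>m \<in> {0, 1, 2, 5, 7}\<close> show ?thesis by (elim insertE emptyE) (simp_all add: best.simps)
    qed
  qed
qed

text \<open>Equality in \<open>best_mult\<close> determines the maximizer. The values 1, 3, 5, 7 are
  exactly the positive parts whose even-rank count equals \<open>best\<close>. From
  \<open>n \<ge> 8\<close> on, both \<open>n\<close> and \<open>x + n\<close> are beyond the
  exceptional sizes, so a 3 can be removed from both sides.\<close>

lemma best_mult_eqD:
  assumes "x \<in> {1, 3, 5, 7}" "best x * best n = best (x + n)"
  shows "best_parts (x + n) = add_mset x (best_parts n)"
  using assms(2)
proof (induction n rule: less_induct)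
  case (less n)
  show ?case
  proof (cases "n \<in> {0, 1, 2, 3, 4, 5, 6, 7}")
    case True
    with assms(1) less.prems show ?thesis
      by (elim insertE emptyE) (simp_all add: best.simps best_parts.simps)
  next
    case False
    define m where "m = n - 3"
    have n: "n = m + 3" "n \<noteq> 5" "n \<noteq> 7" "5 \<le> m" using False by (auto simp: m_def)
    have "best (x + n) = 3 * best (x + m)" "best n = 3 * best m"
      using n by (auto simp: best_rec)
    with less.prems have "best_parts (x + m) = add_mset x (best_parts m)"
      by (intro less.IH) (auto simp: n)
    then show ?thesis
      using n best_parts_rec[of "x + n"] best_parts_rec[of n] by simp
  qed
qed

text \<open>The stride 6 is a common multiple of the periods 2 and 3: over it \<open>growth\<close>
  gains the factor 8 and \<open>best\<close> at least 9.\<close>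

lemma growth_less_best: "5 \<le> n \<Longrightarrow> growth n < 10 * best n"
proof (induction n rule: less_induct)
  case (less n)
  show ?case
  proof (cases "n < 11")
    case True
    with less.prems consider "n = 5" | "n = 6" | "n = 7" | "n = 8" | "n = 9" | "n = 10" by linarith
    then show ?thesis by cases (simp_all add: growth_def best.simps)
  next
    case False
    define m where "m = n - 6"
    have n: "n = m + 2 + 2 + 2" "n = m + 3 + 3" and m: "5 \<le> m" using False by (auto simp: m_def)
    have "growth n = 8 * growth m" by (simp only: n(1) growth_add_2)
    moreover have "9 * best m \<le> best n"
      using best_add_3[of m] best_add_3[of "m + 3"] unfolding n(2) by linarith
    moreover have "growth m < 10 * best m" using m by (intro less.IH) (auto simp: n)
    ultimately show ?thesis by linarith
  qed
qed

lemma rank_count_0_less_best: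
  assumes "0 < n" "n \<notin> {1, 3, 5, 7}"
  shows "rank_count 0 2 n < best n"
proof -
  have small: "\<forall>n\<in>set [8..<22]. rank_count 0 2 n < best n"
    by (simp add: rank_count_eq_parts_count parts_count_eval best.simps del: One_nat_def)
  consider "n \<in> {2, 4, 6}" | "8 \<le> n" "n < 22" | "22 \<le> n" using assms by force
  then show ?thesis
  proof cases
    case 1
    then show ?thesis
      by (elim insertE emptyE) (simp_all add: rank_count_0_values best.simps)
  next
    case 2
    then have "n \<in> set [8..<22]" unfolding set_upt by simp
    with small show ?thesis by blast
  next
    case 3
    then show ?thesis using rank_count_le(1)[of n] growth_less_best[of n] by simp
  qed
qed

lemma rank_count_0_eq_best: "n \<in> {1, 3, 5, 7} \<Longrightarrow> rank_count 0 2 n = best n"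
  by (elim insertE emptyE) (simp_all add: rank_count_0_values best.simps del: One_nat_def)

text \<open>Bound and equality case share one induction: if the head is 1, 3, 5 or 7, equality at
  the end forces equality in the tail bound and in \<open>best_mult\<close>; any other head makes
  the bound strict.\<close>

lemma rank_count_0_partition:
  assumes "\<forall>x\<in>set xs. 0 < x"
  shows "rank_count_partition 0 2 xs \<le> best (sum_list xs) \<and>
    (rank_count_partition 0 2 xs = best (sum_list xs) \<longrightarrow> mset xs = best_parts (sum_list xs))"
  using assms
proof (induction xs)
  case Nil
  then show ?case by (simp add: rank_count_partition_def best.simps best_parts.simps)
next
  case (Cons x xs)
  define s p where "s = sum_list xs" and "p = rank_count_partition 0 2 xs"
  have p: "p \<le> best s" "p = best s \<Longrightarrow> mset xs = best_parts s"
    using Cons by (auto simp: s_def p_def)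
  have prod: "rank_count_partition 0 2 (x # xs) = rank_count 0 2 x * p"
    by (simp add: rank_count_partition_def p_def)
  have mult: "best x * best s \<le> best (x + s)" by (rule best_mult)
  show ?case
  proof (cases "x \<in> {1, 3, 5, 7}")
    case True
    then have x: "rank_count 0 2 x = best x" by (rule rank_count_0_eq_best)
    have le: "best x * p \<le> best x * best s" using p(1) by simp
    then have "best x * p \<le> best (x + s)" using mult by linarith
    moreover have "mset (x # xs) = best_parts (x + s)" if "best x * p = best (x + s)"
    proof -
      have "best x * best s = best (x + s)" using that le mult by linarith
      then have "best_parts (x + s) = add_mset x (best_parts s)" using True by (intro best_mult_eqD)
      moreover have "best x * p = best x * best s"
        using \<open>best x * best s = best (x + s)\<close> that by simp
      then have "p = best s" using best_pos[of x] by simp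
      ultimately show ?thesis using p(2) by simp
    qed
    ultimately show ?thesis using mult by (auto simp: prod x simp flip: s_def)
  next
    case False
    then have "rank_count 0 2 x < best x"
      using Cons.prems by (intro rank_count_0_less_best) auto
    \<comment> \<open>Strictness is obtained against \<open>best s\<close>, which is positive; the
      product \<open>p\<close> over the tail may vanish, since
      \<open>rank_count 0 2 2 = 0\<close>.\<close>
    then have "rank_count 0 2 x * best s < best x * best s" using best_pos[of s] by simp
    moreover have "rank_count 0 2 x * p \<le> rank_count 0 2 x * best s" using p(1) by simp
    ultimately have "rank_count 0 2 x * p < best (x + s)" using mult by linarith
    then show ?thesis by (simp add: prod flip: s_def)
  qed
qed

lemma prod_best_parts: "(\<Prod>x\<in>#best_parts n. rank_count 0 2 x) = best n"
proof (induction n rule: best_parts.induct)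
  case (1 n)
  then show ?case
    by (simp add: best.simps[of n] best_parts.simps[of n] rank_count_0_values[simplified])
qed

lemma sum_best_parts: "sum_mset (best_parts n) = n"
proof (induction n rule: best_parts.induct)
  case (1 n)
  then show ?case by (simp add: best_parts.simps[of n])
qed

lemma best_parts_pos: "x \<in># best_parts n \<Longrightarrow> 0 < x"
proof (induction n rule: best_parts.induct)
  case (1 n)
  then show ?case by (auto simp: best_parts.simps[of n] split: if_splits)
qed

text \<open>From 1, 2 and 4 repeated addition of 3 runs into 5 or 7; from every other start the
  recursion always removes a 3.\<close>

lemma best_add_mult_3:
  assumes "m \<notin> {1, 2, 4}"
  shows "best (m + 3 * k) = best m * 3 ^ k"
    and "best_parts (m + 3 * k) = replicate_mset k 3 + best_parts m"
proof (induction k)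
  case (Suc k)
  have n: "m + 3 * Suc k \<noteq> 5" "m + 3 * Suc k \<noteq> 7" using assms by auto presburger+
  case 1
  then show ?case using Suc best_rec[of "m + 3 * Suc k"] n by simp
  case 2
  then show ?case using Suc best_parts_rec[of "m + 3 * Suc k"] n by simp
qed simp_all

section \<open>Odd rank\<close>

lemma rank_count_1_even:
  assumes "even n" "0 < n"
  shows "rank_count 1 2 n \<le> 2 ^ (n div 2)"
    and "rank_count 1 2 n = 2 ^ (n div 2) \<longleftrightarrow> n \<in> {2, 4, 6}"
proof -
  have small: "\<forall>n\<in>set (map (\<lambda>k. 2 * k) [4..<11]). rank_count 1 2 n < 2 ^ (n div 2)"
    by (simp add: rank_count_eq_parts_count parts_count_eval del: One_nat_def)
  obtain k where k: "n = 2 * k" "0 < k" using assms by auto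
  consider "n \<in> {2, 4, 6}" | "k \<in> {4..<11}" | "22 \<le> n" using k by force
  then have "rank_count 1 2 n = 2 ^ (n div 2) \<and> n \<in> {2, 4, 6} \<or>
    rank_count 1 2 n < 2 ^ (n div 2) \<and> n \<notin> {2, 4, 6}"
  proof cases
    case 1
    then show ?thesis by (elim insertE emptyE) (simp_all add: rank_count_1_values)
  next
    case 2
    then have "n \<in> set (map (\<lambda>k. 2 * k) [4..<11])" unfolding k set_map set_upt by blast
    with small have "rank_count 1 2 n < 2 ^ (n div 2)" by blast
    with 2 k show ?thesis by auto
  next
    case 3
    then have "10 * rank_count 1 2 n \<le> 5 * 2 ^ (n div 2)"
      using rank_count_le(2)[of n] assms by (simp add: growth_def)
    moreover have "0 < (2::nat) ^ (n div 2)" by simp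
    ultimately have "rank_count 1 2 n < 2 ^ (n div 2)" by linarith
    with 3 show ?thesis by auto
  qed
  then show "rank_count 1 2 n \<le> 2 ^ (n div 2)"
    "rank_count 1 2 n = 2 ^ (n div 2) \<longleftrightarrow> n \<in> {2, 4, 6}" by auto
qed

text \<open>The constant is fixed by the best odd part: 8 * 12 = 3 * 2 ^ 5 at 9.\<close>

lemma rank_count_1_odd:
  assumes "odd n"
  shows "8 * rank_count 1 2 n \<le> 3 * 2 ^ (Suc n div 2)"
    and "8 * rank_count 1 2 n = 3 * 2 ^ (Suc n div 2) \<longleftrightarrow> n = 9"
proof -
  have small: "\<forall>n\<in>set (map (\<lambda>k. 2 * k + 1) ([0, 1, 2, 3] @ [5..<11])).
      8 * rank_count 1 2 n < 3 * 2 ^ (Suc n div 2)"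
    by (simp add: rank_count_eq_parts_count parts_count_eval del: One_nat_def)
  obtain k where k: "n = 2 * k + 1" using assms by (auto elim: oddE)
  consider "n = 9" | "k \<in> {0, 1, 2, 3} \<union> {5..<11}" | "22 \<le> n" using k by force
  then have "8 * rank_count 1 2 n = 3 * 2 ^ (Suc n div 2) \<and> n = 9 \<or>
    8 * rank_count 1 2 n < 3 * 2 ^ (Suc n div 2) \<and> n \<noteq> 9"
  proof cases
    case 1
    then show ?thesis by (simp add: rank_count_1_values)
  next
    case 2
    then have "n \<in> set (map (\<lambda>k. 2 * k + 1) ([0, 1, 2, 3] @ [5..<11]))"
      unfolding k set_map set_append set_upt by auto
    with small have "8 * rank_count 1 2 n < 3 * 2 ^ (Suc n div 2)" by blast
    with 2 k show ?thesis by auto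
  next
    case 3
    then have "10 * rank_count 1 2 n \<le> 7 * 2 ^ k"
      using rank_count_le(2)[of n] by (simp add: growth_def k)
    moreover have "0 < (2::nat) ^ k" by simp
    ultimately have "8 * rank_count 1 2 n < 3 * (2 * 2 ^ k)" by linarith
    with 3 show ?thesis by (simp add: k)
  qed
  then show "8 * rank_count 1 2 n \<le> 3 * 2 ^ (Suc n div 2)"
    "8 * rank_count 1 2 n = 3 * 2 ^ (Suc n div 2) \<longleftrightarrow> n = 9" by auto
qed

text \<open>Positivity is asked of the bounds \<open>c\<close> and \<open>d\<close> because the
  counts themselves may vanish, as for odd rank at the part 1.\<close>

lemma mult_eq_iff_nat:
  fixes a b c d :: nat
  assumes "a \<le> c" "b \<le> d" "0 < c" "0 < d"
  shows "a * b = c * d \<longleftrightarrow> a = c \<and> b = d"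
proof
  assume eq: "a * b = c * d"
  have "a * b \<le> a * d" "a * d \<le> c * d" using assms by simp_all
  with eq have "a * d = c * d" by linarith
  then have "a = c" using assms by simp
  with eq assms show "a = c \<and> b = d" by simp
qed simp

text \<open>In an odd sum the number of odd parts is odd. Each of them costs a factor \<open>3/8 * sqrt 2\<close>
  against \<open>sqrt 2 ^ n\<close>, so that optimally there is just one.\<close>

lemma rank_count_1_partition:
  assumes "\<forall>x\<in>set xs. 0 < x"
  defines "p \<equiv> rank_count_partition 1 2 xs" and "n \<equiv> sum_list xs"
  shows "(even n \<longrightarrow> p \<le> 2 ^ (n div 2) \<and> (p = 2 ^ (n div 2) \<longleftrightarrow> set xs \<subseteq> {2, 4, 6})) \<and>
    (odd n \<longrightarrow> 8 * p \<le> 3 * 2 ^ (Suc n div 2) \<and> (8 * p = 3 * 2 ^ (Suc n div 2) \<longleftrightarrow>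
      (\<exists>M. mset xs = add_mset 9 M \<and> set_mset M \<subseteq> {2, 4, 6})))"
  using assms(1) unfolding p_def n_def
proof (induction xs)
  case Nil
  then show ?case by (simp add: rank_count_partition_def)
next
  case (Cons x xs)
  define s p g where "s = sum_list xs" and "p = rank_count_partition 1 2 xs"
    and "g = rank_count 1 2 x"
  have x: "0 < x" using Cons.prems by simp
  have prod: "rank_count_partition 1 2 (x # xs) = g * p"
    by (simp add: rank_count_partition_def p_def g_def)
  have even_s: "p \<le> 2 ^ (s div 2)" "p = 2 ^ (s div 2) \<longleftrightarrow> set xs \<subseteq> {2, 4, 6}" if "even s"
    using Cons that by (simp_all add: s_def p_def)
  have odd_s: "8 * p \<le> 3 * 2 ^ (Suc s div 2)"
    "8 * p = 3 * 2 ^ (Suc s div 2) \<longleftrightarrow> (\<exists>M. mset xs = add_mset 9 M \<and> set_mset M \<subseteq> {2, 4, 6})"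
    if "odd s"
    using Cons that by (simp_all add: s_def p_def)
  note even_x = rank_count_1_even[of x, folded g_def] and odd_x = rank_count_1_odd[of x, folded g_def]
  consider "even x" "even s" | "odd x" "odd s" | "even x" "odd s" | "odd x" "even s" by blast
  then show ?case
  proof cases
    case 1
    then have pow: "2 ^ ((x + s) div 2) = (2::nat) ^ (x div 2) * 2 ^ (s div 2)"
      by (simp flip: power_add)
    have "g * p \<le> 2 ^ (x div 2) * 2 ^ (s div 2)"
      using 1 x even_s even_x by (blast intro: mult_le_mono)
    moreover have "g * p = 2 ^ (x div 2) * 2 ^ (s div 2) \<longleftrightarrow>
        g = 2 ^ (x div 2) \<and> p = 2 ^ (s div 2)"
      using 1 x even_s even_x by (intro mult_eq_iff_nat) auto
    ultimately show ?thesis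
      using 1 x even_s even_x unfolding prod sum_list.Cons s_def[symmetric] pow by auto
  next
    case 2
    then have pow: "2 ^ (Suc x div 2) * 2 ^ (Suc s div 2) = 2 * (2::nat) ^ ((x + s) div 2)"
    proof -
      have "Suc x div 2 + Suc s div 2 = Suc ((x + s) div 2)" using 2 by presburger
      then show ?thesis by (metis power_add power_Suc)
    qed
    have "8 * g * (8 * p) \<le> 3 * 2 ^ (Suc x div 2) * (3 * 2 ^ (Suc s div 2))"
      using 2 odd_s odd_x by (blast intro: mult_le_mono)
    also have "\<dots> = 18 * 2 ^ ((x + s) div 2)" using pow by simp
    \<comment> \<open>Two odd contributions together lose the factor 18/64, so the even bound is
      missed strictly.\<close>
    finally have "64 * (g * p) \<le> 18 * 2 ^ ((x + s) div 2)" by simp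
    moreover have "0 < (2::nat) ^ ((x + s) div 2)" by simp
    ultimately have "g * p < 2 ^ ((x + s) div 2)" by linarith
    moreover have "\<not> set (x # xs) \<subseteq> {2, 4, 6}" using 2 by auto
    \<comment> \<open>Both sides of the equivalence are false here.\<close>
    ultimately have "g * p \<le> 2 ^ ((x + s) div 2) \<and>
        (g * p = 2 ^ ((x + s) div 2) \<longleftrightarrow> set (x # xs) \<subseteq> {2, 4, 6})"
      by (simp only: less_imp_le nat_less_le simp_thms)
    moreover have "even (x + s)" using 2 by simp
    ultimately show ?thesis unfolding prod sum_list.Cons s_def[symmetric] by blast
  next
    case 3
    then have pow: "3 * 2 ^ (Suc (x + s) div 2) = 2 ^ (x div 2) * (3 * (2::nat) ^ (Suc s div 2))"
    proof -
      have "Suc (x + s) div 2 = x div 2 + Suc s div 2" using 3 by presburger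
      then show ?thesis by (simp add: power_add)
    qed
    have ass: "8 * (g * p) = g * (8 * p)" by simp
    have "g * (8 * p) \<le> 2 ^ (x div 2) * (3 * 2 ^ (Suc s div 2))"
      using 3 x odd_s even_x by (blast intro: mult_le_mono)
    moreover have "g * (8 * p) = 2 ^ (x div 2) * (3 * 2 ^ (Suc s div 2)) \<longleftrightarrow>
        g = 2 ^ (x div 2) \<and> 8 * p = 3 * 2 ^ (Suc s div 2)"
      using 3 x odd_s even_x by (intro mult_eq_iff_nat) auto
    \<comment> \<open>Since \<open>x\<close> is even, the single 9 must lie in the tail.\<close>
    moreover have "(\<exists>M. mset (x # xs) = add_mset 9 M \<and> set_mset M \<subseteq> {2, 4, 6}) \<longleftrightarrow>
        x \<in> {2, 4, 6} \<and> (\<exists>M. mset xs = add_mset 9 M \<and> set_mset M \<subseteq> {2, 4, 6})" (is "?l \<longleftrightarrow> ?r")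
    proof
      assume ?l
      then obtain M where M: "add_mset x (mset xs) = add_mset 9 M" "set_mset M \<subseteq> {2, 4, 6}" by auto
      moreover have "x \<noteq> 9" using 3 by auto
      ultimately obtain K where "mset xs = add_mset 9 K" "M = add_mset x K"
        by (auto simp: add_eq_conv_ex)
      with M show ?r by auto
    next
      assume ?r
      then obtain M where "mset xs = add_mset 9 M" "set_mset M \<subseteq> {2, 4, 6}" "x \<in> {2, 4, 6}" by auto
      then show ?l by (intro exI[of _ "add_mset x M"]) auto
    qed
    ultimately show ?thesis
      using 3 x odd_s even_x unfolding prod ass sum_list.Cons s_def[symmetric] pow by auto
  next
    case 4
    then have pow: "3 * 2 ^ (Suc (x + s) div 2) = 3 * 2 ^ (Suc x div 2) * (2::nat) ^ (s div 2)"
    proof -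
      have "Suc (x + s) div 2 = Suc x div 2 + s div 2" using 4 by presburger
      then show ?thesis by (simp add: power_add)
    qed
    have ass: "8 * (g * p) = 8 * g * p" by simp
    have "8 * g * p \<le> 3 * 2 ^ (Suc x div 2) * 2 ^ (s div 2)"
      using 4 x even_s odd_x by (blast intro: mult_le_mono)
    moreover have "8 * g * p = 3 * 2 ^ (Suc x div 2) * 2 ^ (s div 2) \<longleftrightarrow>
        8 * g = 3 * 2 ^ (Suc x div 2) \<and> p = 2 ^ (s div 2)"
      using 4 x even_s odd_x by (intro mult_eq_iff_nat) auto
    moreover have "(\<exists>M. mset (x # xs) = add_mset 9 M \<and> set_mset M \<subseteq> {2, 4, 6}) \<longleftrightarrow>
        x = 9 \<and> set xs \<subseteq> {2, 4, 6}" (is "?l \<longleftrightarrow> ?r")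
    proof
      assume ?l
      then obtain M where M: "add_mset x (mset xs) = add_mset 9 M" "set_mset M \<subseteq> {2, 4, 6}" by auto
      \<comment> \<open>An odd \<open>x\<close> cannot be among 2, 4, 6, so it is the 9
        itself.\<close>
      moreover have "x \<notin># M" using 4 M(2) by auto
      ultimately have "x = 9" "mset xs = M" by (auto simp: add_eq_conv_ex)
      then show ?r using M(2) by auto
    qed auto
    ultimately show ?thesis
      using 4 x even_s odd_x unfolding prod ass sum_list.Cons s_def[symmetric] pow by auto
  qed
qed

section \<open>The substitution steps\<close>

text \<open>\<open>A\<close> collects the parts already finished: each 4 or 6 of \<open>M\<close> is
  created from twos by one step and then moved into \<open>A\<close>, hence \<open>A\<close> is
  arbitrary in the induction.\<close>

lemma subst_steps_reach:
  assumes "set_mset M \<subseteq> {2, 4, 6}"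
  shows "subst_step\<^sup>*\<^sup>* (sorted_list_of_multiset (replicate_mset (sum_mset M div 2) 2 + A))
     (sorted_list_of_multiset (M + A))"
  using assms
proof (induction M arbitrary: A)
  case empty
  then show ?case by simp
next
  case (add x M)
  let ?l = sorted_list_of_multiset
  let ?R = "replicate_mset (sum_mset M div 2) (2::nat)"
  have IH: "subst_step\<^sup>*\<^sup>* (?l (?R + add_mset x A)) (?l (M + add_mset x A))"
    using add.IH[of "add_mset x A"] add.prems by simp
  consider "x = 2" | "x = 4" | "x = 6" using add.prems by auto
  then have "subst_step\<^sup>*\<^sup>* (?l (replicate_mset (sum_mset (add_mset x M) div 2) 2 + A))
      (?l (?R + add_mset x A))"
  proof cases
    case 1
    then show ?thesis by simp
  next
    case 2
    have "subst_step (?l (?R + A + {#2, 2#})) (?l (?R + add_mset x A))"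
      by (rule two_twos[where M = "?R + A"]) (simp_all add: 2 del: sorted_list_of_multiset_insert)
    moreover have "replicate_mset (sum_mset (add_mset x M) div 2) 2 + A = ?R + A + {#2, 2#}"
    proof -
      have "sum_mset (add_mset x M) div 2 = Suc (Suc (sum_mset M div 2))" by (simp add: 2)
      then show ?thesis by simp
    qed
    ultimately show ?thesis by (simp only: r_into_rtranclp)
  next
    case 3
    have "subst_step (?l (?R + A + {#2, 2, 2#})) (?l (?R + add_mset x A))"
      by (rule three_twos[where M = "?R + A"]) (simp_all add: 3 del: sorted_list_of_multiset_insert)
    moreover have "replicate_mset (sum_mset (add_mset x M) div 2) 2 + A = ?R + A + {#2, 2, 2#}"
    proof -
      have "sum_mset (add_mset x M) div 2 = Suc (Suc (Suc (sum_mset M div 2)))" by (simp add: 3)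
      then show ?thesis by simp
    qed
    ultimately show ?thesis by (simp only: r_into_rtranclp)
  qed
  with IH show ?case by (simp del: sorted_list_of_multiset_insert)
qed

text \<open>As \<open>A\<close> contains no 2, each step acts inside the block of parts 2, 4, 6 and
  preserves its sum.\<close>

lemma subst_steps_invariant:
  assumes "subst_step\<^sup>*\<^sup>* xs ys" "sorted xs" "mset xs = M + A" "set_mset M \<subseteq> {2, 4, 6}" "2 \<notin># A"
  shows "sorted ys \<and> (\<exists>K. mset ys = K + A \<and> set_mset K \<subseteq> {2, 4, 6} \<and> sum_mset K = sum_mset M)"
  using assms(1)
proof (induction rule: rtranclp_induct)
  case base
  then show ?case using assms by blast
next
  case (step ys zs)
  then obtain K where K: "mset ys = K + A" "set_mset K \<subseteq> {2, 4, 6}" "sum_mset K = sum_mset M" by auto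
  \<comment> \<open>The removed twos \<open>L\<close> can be taken from \<open>K\<close>
    alone.\<close>
  have *: "K = L + (K - L) \<and> N = K - L + A" if "K + A = N + L" "set_mset L \<subseteq> {2}" for L N
  proof -
    have "L \<subseteq># K"
    proof (rule mset_subset_eqI)
      fix a
      have "count L a \<le> count (K + A) a" using that by simp
      moreover have "count L a = 0" if "a \<noteq> 2"
        using that \<open>set_mset L \<subseteq> {2}\<close> by (auto simp: not_in_iff[symmetric])
      moreover have "count A 2 = 0" using assms(5) by (simp add: not_in_iff)
      ultimately show "count L a \<le> count K a" by (cases "a = 2") auto
    qed
    then obtain J where "K = L + J" by (auto simp: mset_subset_eq_exists_conv)
    with that show ?thesis by (auto simp: algebra_simps)
  qed
  from step.hyps(2) show ?case
  proof cases
    case (two_twos N)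
    with K * [of N "{#2, 2#}"] have "K = {#2, 2#} + (K - {#2, 2#})" "N = K - {#2, 2#} + A" by auto
    moreover define J where "J = K - {#2, 2#}"
    ultimately have J: "K = {#2, 2#} + J" "N = J + A" by simp_all
    then show ?thesis using two_twos K
      by (intro conjI exI[of _ "add_mset 4 J"]) auto
  next
    case (three_twos N)
    with K * [of N "{#2, 2, 2#}"] have "K = {#2, 2, 2#} + (K - {#2, 2, 2#})" "N = K - {#2, 2, 2#} + A" by auto
    moreover define J where "J = K - {#2, 2, 2#}"
    ultimately have J: "K = {#2, 2, 2#} + J" "N = J + A" by simp_all
    then show ?thesis using three_twos K
      by (intro conjI exI[of _ "add_mset 6 J"]) auto
  qed
qed

text \<open>Translates reachability into the form of the equality cases for odd rank; it is applied
  with \<open>A\<close> empty for even \<open>n\<close> and \<open>A = {#9#}\<close> for odd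
  \<open>n\<close>.\<close>

lemma subst_steps_iff:
  assumes "sorted xs" "mset xs = replicate_mset k 2 + A" "2 \<notin># A"
  shows "subst_step\<^sup>*\<^sup>* xs ys \<longleftrightarrow>
    sorted ys \<and> (\<exists>M. mset ys = M + A \<and> set_mset M \<subseteq> {2, 4, 6} \<and> sum_mset M = 2 * k)"
proof
  assume "subst_step\<^sup>*\<^sup>* xs ys"
  from subst_steps_invariant[OF this assms(1,2) _ assms(3)]
  show "sorted ys \<and> (\<exists>M. mset ys = M + A \<and> set_mset M \<subseteq> {2, 4, 6} \<and> sum_mset M = 2 * k)"
    by (auto simp: mult.commute split: if_splits)
next
  assume "sorted ys \<and> (\<exists>M. mset ys = M + A \<and> set_mset M \<subseteq> {2, 4, 6} \<and> sum_mset M = 2 * k)"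
  then obtain M where M: "sorted ys" "mset ys = M + A" "set_mset M \<subseteq> {2, 4, 6}" "sum_mset M = 2 * k"
    by auto
  have "sorted_list_of_multiset (mset zs) = zs" if "sorted zs" for zs :: "nat list"
    using that by (simp add: sorted_sort_id)
  from this[OF assms(1)] this[OF M(1)] show "subst_step\<^sup>*\<^sup>* xs ys"
    using subst_steps_reach[OF M(3), of A] by (simp add: assms(2) M)
qed

section \<open>Maximizers\<close>

lemma maximizersI:
  assumes "\<And>xs. xs \<in> partitions n \<Longrightarrow> rank_count_partition r t xs \<le> B"
    and "ys \<in> partitions n" "rank_count_partition r t ys = B"
  shows "max_rank_count r t n = B"
    and "maximizers r t n = {xs \<in> partitions n. rank_count_partition r t xs = B}"
proof -
  show "max_rank_count r t n = B"
    unfolding max_rank_count_def using assms finite_partitions[of n]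
    by (intro Max_eqI) auto
  then show "maximizers r t n = {xs \<in> partitions n. rank_count_partition r t xs = B}"
    by (simp add: maximizers_def)
qed

lemma rank_count_partition_mset:
  "rank_count_partition r t xs = (\<Prod>x\<in>#mset xs. rank_count r t x)"
  by (simp add: rank_count_partition_def flip: prod_mset_prod_list)

lemma maximizers_0:
  assumes "sorted ys" "mset ys = best_parts n"
  shows "max_rank_count 0 2 n = best n" "maximizers 0 2 n = {ys}"
proof -
  have bound: "rank_count_partition 0 2 xs \<le> best n \<and>
      (rank_count_partition 0 2 xs = best n \<longrightarrow> mset xs = best_parts n)"
    if "xs \<in> partitions n" for xs
    using that rank_count_0_partition[of xs] by (auto simp: partitions_def)
  have "sum_list ys = n"
    using assms(2) sum_best_parts[of n] by (metis sum_mset_sum_list)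
  moreover have "\<forall>y\<in>set ys. 0 < y"
    using assms(2) best_parts_pos[of _ n] by (metis set_mset_mset)
  ultimately have ys: "ys \<in> partitions n" "rank_count_partition 0 2 ys = best n"
    using assms by (simp_all add: partitions_def rank_count_partition_mset prod_best_parts)
  have eq: "xs = ys" if "xs \<in> partitions n" "rank_count_partition 0 2 xs = best n" for xs
  proof -
    have "mset xs = mset ys" "sorted xs" using that bound[of xs] assms by (auto simp: partitions_def)
    with assms(1) show ?thesis by (metis properties_for_sort)
  qed
  show "max_rank_count 0 2 n = best n"
    by (rule maximizersI(1)[OF _ ys]) (use bound in blast)
  have max: "maximizers 0 2 n = {xs \<in> partitions n. rank_count_partition 0 2 xs = best n}"
    by (rule maximizersI(2)[OF _ ys]) (use bound in blast)
  show "maximizers 0 2 n = {ys}" unfolding max using ys eq by blast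
qed

lemma maximizers_1_even:
  assumes "even n"
  shows "max_rank_count 1 2 n = 2 ^ (n div 2)"
    and "maximizers 1 2 n = {xs. subst_step\<^sup>*\<^sup>* (replicate (n div 2) 2) xs}"
proof -
  obtain k where k: "n = 2 * k" using assms by blast
  have bound: "rank_count_partition 1 2 xs \<le> 2 ^ (n div 2)"
    "rank_count_partition 1 2 xs = 2 ^ (n div 2) \<longleftrightarrow> set xs \<subseteq> {2, 4, 6}"
    if "xs \<in> partitions n" for xs
    using that rank_count_1_partition[of xs] assms by (auto simp: partitions_def)
  have ys: "replicate k 2 \<in> partitions n"
    by (simp add: partitions_def k sum_list_replicate)
  have eq: "rank_count_partition 1 2 (replicate k 2) = 2 ^ (n div 2)"
    using bound(2)[OF ys] by auto
  show "max_rank_count 1 2 n = 2 ^ (n div 2)"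
    by (rule maximizersI(1)[OF bound(1) ys eq])
  have max: "maximizers 1 2 n = {xs \<in> partitions n. rank_count_partition 1 2 xs = 2 ^ (n div 2)}"
    by (rule maximizersI(2)[OF bound(1) ys eq])
  have "xs \<in> maximizers 1 2 n \<longleftrightarrow> subst_step\<^sup>*\<^sup>* (replicate k 2) xs" for xs
  proof -
    have "xs \<in> maximizers 1 2 n \<longleftrightarrow> xs \<in> partitions n \<and> set xs \<subseteq> {2, 4, 6}"
      using bound(2)[of xs] by (auto simp: max)
    also have "\<dots> \<longleftrightarrow> sorted xs \<and>
        (\<exists>M. mset xs = M + {#} \<and> set_mset M \<subseteq> {2, 4, 6} \<and> sum_mset M = 2 * k)"
      by (auto simp: partitions_def k sum_mset_sum_list)
    also have "\<dots> \<longleftrightarrow> subst_step\<^sup>*\<^sup>* (replicate k 2) xs"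
      by (rule subst_steps_iff[symmetric]) simp_all
    finally show ?thesis .
  qed
  then show "maximizers 1 2 n = {xs. subst_step\<^sup>*\<^sup>* (replicate (n div 2) 2) xs}"
    by (auto simp: k)
qed

lemma maximizers_1_odd:
  assumes "odd n" "9 \<le> n"
  shows "max_rank_count 1 2 n = 12 * 2 ^ ((n - 9) div 2)"
    and "maximizers 1 2 n = {xs. subst_step\<^sup>*\<^sup>* (replicate ((n - 9) div 2) 2 @ [9]) xs}"
proof -
  define k where "k = (n - 9) div 2"
  have n: "n = 2 * k + 9" using assms unfolding k_def by presburger
  \<comment> \<open>With n = 2 * k + 9 the exponent is k + 5, and 3 * 32 = 8 * 12.\<close>
  have pow: "3 * 2 ^ (Suc n div 2) = 8 * (12 * 2 ^ k :: nat)"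
    by (simp add: n power_add)
  have bound: "rank_count_partition 1 2 xs \<le> 12 * 2 ^ k"
    "rank_count_partition 1 2 xs = 12 * 2 ^ k \<longleftrightarrow>
      (\<exists>M. mset xs = add_mset 9 M \<and> set_mset M \<subseteq> {2, 4, 6})"
    if "xs \<in> partitions n" for xs
  proof -
    have sum: "sum_list xs = n" and pos: "\<forall>x\<in>set xs. 0 < x"
      using that by (auto simp: partitions_def)
    have "8 * rank_count_partition 1 2 xs \<le> 3 * 2 ^ (Suc n div 2) \<and>
      (8 * rank_count_partition 1 2 xs = 3 * 2 ^ (Suc n div 2) \<longleftrightarrow>
        (\<exists>M. mset xs = add_mset 9 M \<and> set_mset M \<subseteq> {2, 4, 6}))"
      using rank_count_1_partition[OF pos, unfolded sum] assms(1) by blast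
    then show "rank_count_partition 1 2 xs \<le> 12 * 2 ^ k"
      "rank_count_partition 1 2 xs = 12 * 2 ^ k \<longleftrightarrow>
        (\<exists>M. mset xs = add_mset 9 M \<and> set_mset M \<subseteq> {2, 4, 6})"
      unfolding pow by auto
  qed
  have ys: "replicate k 2 @ [9] \<in> partitions n"
    by (simp add: partitions_def n sum_list_replicate sorted_append)
  have eq: "rank_count_partition 1 2 (replicate k 2 @ [9]) = 12 * 2 ^ k"
    by (subst bound(2)[OF ys]) (auto intro!: exI[of _ "replicate_mset k 2"])
  show "max_rank_count 1 2 n = 12 * 2 ^ ((n - 9) div 2)"
    unfolding k_def[symmetric] by (rule maximizersI(1)[OF bound(1) ys eq])
  have max: "maximizers 1 2 n = {xs \<in> partitions n. rank_count_partition 1 2 xs = 12 * 2 ^ k}"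
    by (rule maximizersI(2)[OF bound(1) ys eq])
  have "xs \<in> maximizers 1 2 n \<longleftrightarrow> subst_step\<^sup>*\<^sup>* (replicate k 2 @ [9]) xs" for xs
  proof -
    have "xs \<in> maximizers 1 2 n \<longleftrightarrow>
        xs \<in> partitions n \<and> (\<exists>M. mset xs = add_mset 9 M \<and> set_mset M \<subseteq> {2, 4, 6})"
      using bound(2)[of xs] by (auto simp: max)
    also have "\<dots> \<longleftrightarrow> sorted xs \<and>
        (\<exists>M. mset xs = M + {#9#} \<and> set_mset M \<subseteq> {2, 4, 6} \<and> sum_mset M = 2 * k)" (is "?l \<longleftrightarrow> ?r")
    proof
      assume ?l
      then obtain M where M: "mset xs = add_mset 9 M" "set_mset M \<subseteq> {2, 4, 6}" "sorted xs"
        "sum_list xs = n" by (auto simp: partitions_def)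
      then have "sum_mset M = 2 * k" using sum_mset_sum_list[of xs] by (simp add: n)
      with M show ?r by auto
    next
      assume ?r
      then obtain M where M: "mset xs = add_mset 9 M" "set_mset M \<subseteq> {2, 4, 6}" "sorted xs"
        "sum_mset M = 2 * k" by auto
      then have "sum_list xs = n" using sum_mset_sum_list[of xs] by (simp add: n)
      moreover have "0 < x" if "x \<in> set xs" for x
        using that M(2) unfolding set_mset_mset[symmetric] M(1) by auto
      ultimately show ?l using M by (auto simp: partitions_def)
    qed
    also have "\<dots> \<longleftrightarrow> subst_step\<^sup>*\<^sup>* (replicate k 2 @ [9]) xs"
      by (rule subst_steps_iff[symmetric]) (simp_all add: sorted_append)
    finally show ?thesis .
  qed
  then show "maximizers 1 2 n = {xs. subst_step\<^sup>*\<^sup>* (replicate ((n - 9) div 2) 2 @ [9]) xs}"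
    by (auto simp: k_def)
qed

theorem theorem1p5:
  "(\<forall>n::nat. n \<ge> 5 \<longrightarrow>
      (n mod 3 = 0 \<longrightarrow>
         max_rank_count 0 2 n = 3 ^ (n div 3) \<and>
         maximizers 0 2 n = {replicate (n div 3) 3}) \<and>
      (n mod 3 = 1 \<longrightarrow>
         max_rank_count 0 2 n = 11 * 3 ^ ((n - 7) div 3) \<and>
         maximizers 0 2 n = {replicate ((n - 7) div 3) 3 @ [7]}) \<and>
      (n mod 3 = 2 \<longrightarrow>
         max_rank_count 0 2 n = 5 * 3 ^ ((n - 5) div 3) \<and>
         maximizers 0 2 n = {replicate ((n - 5) div 3) 3 @ [5]})) \<and>
   (\<forall>n::nat. n \<ge> 8 \<longrightarrow>
      (n mod 2 = 0 \<longrightarrow>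
         max_rank_count 1 2 n = 2 ^ (n div 2) \<and>
         maximizers 1 2 n = {xs. subst_step\<^sup>*\<^sup>* (replicate (n div 2) 2) xs}) \<and>
      (n mod 2 = 1 \<longrightarrow>
         max_rank_count 1 2 n = 12 * 2 ^ ((n - 9) div 2) \<and>
         maximizers 1 2 n = {xs. subst_step\<^sup>*\<^sup>* (replicate ((n - 9) div 2) 2 @ [9]) xs}))"
proof (intro conjI allI impI)
  fix n :: nat
  assume n: "5 \<le> n"
  {
    assume "n mod 3 = 0"
    then obtain k where k: "n = 3 * k" by blast
    have "best_parts n = mset (replicate k 3)" "best n = 3 ^ k"
      using best_add_mult_3[of 0 k] by (simp_all add: k best.simps[of 0] best_parts.simps[of 0])
    with maximizers_0[of "replicate k 3" n]
    show "max_rank_count 0 2 n = 3 ^ (n div 3)" "maximizers 0 2 n = {replicate (n div 3) 3}"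
      by (simp_all add: k)
  }
  {
    assume mod: "n mod 3 = 1"
    define k where "k = (n - 7) div 3"
    \<comment> \<open>Remainder 1 together with \<open>5 \<le> n\<close> forces
      \<open>7 \<le> n\<close>, so the truncated subtraction is exact.\<close>
    have k: "n = 7 + 3 * k" using mod n unfolding k_def by presburger
    have "best_parts n = mset (replicate k 3 @ [7])" "best n = 11 * 3 ^ k"
      using best_add_mult_3[of 7 k] by (simp_all add: k best.simps[of 7] best_parts.simps[of 7])
    with maximizers_0[of "replicate k 3 @ [7]" n]
    show "max_rank_count 0 2 n = 11 * 3 ^ ((n - 7) div 3)"
      "maximizers 0 2 n = {replicate ((n - 7) div 3) 3 @ [7]}"
      by (simp_all add: sorted_append flip: k_def)
  }
  {
    assume mod: "n mod 3 = 2"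
    define k where "k = (n - 5) div 3"
    have k: "n = 5 + 3 * k" using mod n unfolding k_def by presburger
    have "best_parts n = mset (replicate k 3 @ [5])" "best n = 5 * 3 ^ k"
      using best_add_mult_3[of 5 k] by (simp_all add: k best.simps[of 5] best_parts.simps[of 5])
    with maximizers_0[of "replicate k 3 @ [5]" n]
    show "max_rank_count 0 2 n = 5 * 3 ^ ((n - 5) div 3)"
      "maximizers 0 2 n = {replicate ((n - 5) div 3) 3 @ [5]}"
      by (simp_all add: sorted_append flip: k_def)
  }
next
  fix n :: nat
  assume n: "8 \<le> n"
  {
    assume "n mod 2 = 0"
    then have "even n" by presburger
    then show "max_rank_count 1 2 n = 2 ^ (n div 2)"
      "maximizers 1 2 n = {xs. subst_step\<^sup>*\<^sup>* (replicate (n div 2) 2) xs}"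
      by (rule maximizers_1_even)+
  }
  {
    assume "n mod 2 = 1"
    with n have "odd n" "9 \<le> n" by presburger+
    then show "max_rank_count 1 2 n = 12 * 2 ^ ((n - 9) div 2)"
      "maximizers 1 2 n = {xs. subst_step\<^sup>*\<^sup>* (replicate ((n - 9) div 2) 2 @ [9]) xs}"
      by (rule maximizers_1_odd)+
  }
qed

end
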